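(* Let $(X,T)$ be a $\mathbb{Z}^2$-t.d.s. with metric $d$, let $\mu\in M(X,T)$, and let $\vec{v}=(1,\beta)\in\mathbb{R}^2$ be a direction vector. Then for any $b\in(0,\infty)$ the following two statements are equivalent: (a) $\mu$ has bounded complexity with respect to $\{d_k^{\vec{v},b}\}_{k=1}^\infty$; (b) $T$ is $(\mu,\vec{v},b)$-equicontinuous.
   Context: A $\mathbb{Z}^2$-t.d.s. $(X,T)$ is a compact metric space $(X,d)$ with a group homomorphism $\vec{w}\mapsto T^{\vec{w}}$ from $\mathbb{Z}^2$ to the group of homeomorphisms of $X$. $M(X,T)$ is the set of Borel probability measures $\mu$ on $X$ with $\mu(T^{-\vec{w}}A)=\mu(A)$ for all $\vec{w}\in\mathbb{Z}^2$ and Borel $A$. For $b>0$ let $\Lambda^{\vec{v}}(b)=\{(m,n)\in\mathbb{Z}^2:\beta m-b\le n\le\beta m+b\}$ and, for $k\in\mathbb{N}=\{1,2,\dots\}$, $\Lambda_k^{\vec{v}}(b)=\Lambda^{\vec{v}}(b)\cap(\{0,1,\dots,k-1\}\times\mathbb{Z})$. For $x,y\in X$ define $$d_k^{\vec{v},b}(x,y)=\max_{(m,n)\in\Lambda_k^{\vec{v}}(b)}d(T^{(m,n)}x,T^{(m,n)}y),$$ and $B_{d_k^{\vec{v},b}}(x,\epsilon)=\{y\in X:d_k^{\vec{v},b}(x,y)<\epsilon\}$. $\mu$ has bounded complexity with respect to $\{d_k^{\vec{v},b}\}$ if for every $\epsilon>0$ there is a positive integer $C=C(\epsilon)$ such that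 for every $k\in\mathbb{N}$ there is a finite $F\subset X$ with cardinality $\#(F)\le C$ and $\mu\big(\bigcup_{x\in F}B_{d_k^{\vec{v},b}}(x,\epsilon)\big)>1-\epsilon$. A subset $K\subset X$ is $(\vec{v},b)$-equicontinuous if for every $\epsilon>0$ there is $\delta>0$ such that for all $x,y\in K$ with $d(x,y)<\delta$, $d(T^{(m,n)}x,T^{(m,n)}y)<\epsilon$ for all $(m,n)\in\Lambda^{\vec{v}}(b)$. $T$ is $(\mu,\vec{v},b)$-equicontinuous if for every $\tau>0$ there is a $(\vec{v},b)$-equicontinuous measurable subset $K\subset X$ with $\mu(K)>1-\tau$. *)

theory Defs
  imports "HOL-Probability.Probability"
begin

text \<open>
  The space is a whole type of class \<^class>\<open>metric_space\<close>, so the metric is \<^const>\<open>dist\<close>.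
  The direction vector is $(1,\beta)$ and enters the definitions through its slope $\beta$.
\<close>

text \<open>
  The identity at the zero vector follows from multiplicativity and bijectivity.
\<close>

definition Z2_tds :: "(int \<times> int \<Rightarrow> 'a::metric_space \<Rightarrow> 'a) \<Rightarrow> bool" where
  "Z2_tds T \<longleftrightarrow>
     compact (UNIV :: 'a set) \<and>
     (\<forall>w. \<exists>g. homeomorphism UNIV UNIV (T w) g) \<and>
     (\<forall>v w. T (v + w) = T v \<circ> T w)"

definition invariant_measures :: "(int \<times> int \<Rightarrow> 'a::metric_space \<Rightarrow> 'a) \<Rightarrow> 'a measure set" where
  "invariant_measures T =
     {\<mu>. prob_space \<mu> \<and> sets \<mu> = sets borel \<and>
         (\<forall>w. \<forall>A\<in>sets borel. measure \<mu> (T (- w) ` A) = measure \<mu> A)}"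

definition strip :: "real \<Rightarrow> real \<Rightarrow> (int \<times> int) set" where
  "strip \<beta> b = {(m, n). \<beta> * real_of_int m - b \<le> real_of_int n \<and>
                        real_of_int n \<le> \<beta> * real_of_int m + b}"

definition strip_upto :: "real \<Rightarrow> real \<Rightarrow> nat \<Rightarrow> (int \<times> int) set" where
  "strip_upto \<beta> b k = strip \<beta> b \<inter> ({0..<int k} \<times> UNIV)"

text \<open>
  For $b > 0$ and $k \ge 1$ the index set is finite and contains $(0,0)$, so that \<^const>\<open>Max\<close>
  below is a genuine maximum.
\<close>

lemma finite_strip_upto: "finite (strip_upto \<beta> b k)"
proof (rule finite_subset)
  show "strip_upto \<beta> b k \<subseteq>
      (SIGMA m:{0..<int k}. {\<lfloor>\<beta> * real_of_int m - b\<rfloor>..\<lceil>\<beta> * real_of_int m + b\<rceil>})"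
    by (auto simp: strip_upto_def strip_def) linarith+
qed auto

lemma zero_in_strip_upto: "b > 0 \<Longrightarrow> k \<ge> 1 \<Longrightarrow> (0, 0) \<in> strip_upto \<beta> b k"
  by (auto simp: strip_upto_def strip_def)

definition dyn_dist ::
  "(int \<times> int \<Rightarrow> 'a::metric_space \<Rightarrow> 'a) \<Rightarrow> real \<Rightarrow> real \<Rightarrow> nat \<Rightarrow> 'a \<Rightarrow> 'a \<Rightarrow> real" where
  "dyn_dist T \<beta> b k x y = Max ((\<lambda>w. dist (T w x) (T w y)) ` strip_upto \<beta> b k)"

definition dyn_ball ::
  "(int \<times> int \<Rightarrow> 'a::metric_space \<Rightarrow> 'a) \<Rightarrow> real \<Rightarrow> real \<Rightarrow> nat \<Rightarrow> 'a \<Rightarrow> real \<Rightarrow> 'a set" where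
  "dyn_ball T \<beta> b k x \<epsilon> = {y. dyn_dist T \<beta> b k x y < \<epsilon>}"

definition bounded_complexity ::
  "(int \<times> int \<Rightarrow> 'a::metric_space \<Rightarrow> 'a) \<Rightarrow> 'a measure \<Rightarrow> real \<Rightarrow> real \<Rightarrow> bool" where
  "bounded_complexity T \<mu> \<beta> b \<longleftrightarrow>
     (\<forall>\<epsilon>>0. \<exists>C::nat. C > 0 \<and>
        (\<forall>k\<ge>1. \<exists>F. finite F \<and> card F \<le> C \<and>
           measure \<mu> (\<Union>x\<in>F. dyn_ball T \<beta> b k x \<epsilon>) > 1 - \<epsilon>))"

definition equicontinuous_set ::
  "(int \<times> int \<Rightarrow> 'a::metric_space \<Rightarrow> 'a) \<Rightarrow> real \<Rightarrow> real \<Rightarrow> 'a set \<Rightarrow> bool" where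
  "equicontinuous_set T \<beta> b K \<longleftrightarrow>
     (\<forall>\<epsilon>>0. \<exists>\<delta>>0. \<forall>x\<in>K. \<forall>y\<in>K. dist x y < \<delta> \<longrightarrow>
        (\<forall>w\<in>strip \<beta> b. dist (T w x) (T w y) < \<epsilon>))"

definition measure_equicontinuous ::
  "(int \<times> int \<Rightarrow> 'a::metric_space \<Rightarrow> 'a) \<Rightarrow> 'a measure \<Rightarrow> real \<Rightarrow> real \<Rightarrow> bool" where
  "measure_equicontinuous T \<mu> \<beta> b \<longleftrightarrow>
     (\<forall>\<tau>>0. \<exists>K\<in>sets \<mu>. equicontinuous_set T \<beta> b K \<and> measure \<mu> K > 1 - \<tau>)"

end

theory Submission
  imports Defs
begin

text \<open>
  Equicontinuity on a set of large measure bounds the complexity by compactness. Conversely,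
  invariance of \<open>\<mu>\<close> lets the one-sided windows be recentred, so bounded complexity holds for two-sided
  windows as well. Limits of the at most \<open>C\<close> centres, along a subsequence of windows, give finitely
  many closed cells of small diameter in the strip metric, of total measure at least \<open>1 - \<epsilon>\<close>.
  Intersecting these finite unions over a summable sequence of \<open>\<epsilon>\<close> yields the equicontinuous set.
\<close>

section \<open>Finiteness and compactness in metric spaces\<close>

lemma finite_uniform_dist:
  fixes P :: "'i \<Rightarrow> 'a::metric_space \<Rightarrow> 'a \<Rightarrow> bool"
  assumes "finite I" and "\<And>i. i \<in> I \<Longrightarrow> \<exists>d>0. \<forall>x y. dist x y < d \<longrightarrow> P i x y"
  shows "\<exists>d>0. \<forall>i\<in>I. \<forall>x y. dist x y < d \<longrightarrow> P i x y"
  using assms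
proof (induction I)
  case empty
  show ?case by (auto intro: exI[of _ 1])
next
  case (insert i I)
  obtain d where d: "d > 0" "\<forall>i\<in>I. \<forall>x y. dist x y < d \<longrightarrow> P i x y"
    using insert by auto
  obtain e where e: "e > 0" "\<forall>x y. dist x y < e \<longrightarrow> P i x y"
    using insert.prems[of i] by blast
  show ?case
    using d e by (intro exI[of _ "min d e"]) auto
qed

text \<open>Finitely many successive extractions suffice: passing to a further subsequence keeps the
  limits already obtained.\<close>

lemma compact_convergent_subseq_family:
  fixes g :: "nat \<Rightarrow> nat \<Rightarrow> 'a::metric_space"
  assumes "compact (UNIV :: 'a set)"
  shows "\<exists>r l. strict_mono (r :: nat \<Rightarrow> nat) \<and> (\<forall>i<C. (\<lambda>k. g (r k) i) \<longlonglongrightarrow> l i)"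
proof (induction C)
  case 0
  show ?case by (auto intro: exI[of _ id] simp: strict_mono_def)
next
  case (Suc C)
  then obtain r l where r: "strict_mono (r :: nat \<Rightarrow> nat)"
    and l: "\<And>i. i < C \<Longrightarrow> (\<lambda>k. g (r k) i) \<longlonglongrightarrow> l i" by blast
  obtain p and q :: "nat \<Rightarrow> nat" where q: "strict_mono q"
    and p: "((\<lambda>k. g (r k) C) \<circ> q) \<longlonglongrightarrow> p"
    using assms unfolding compact_def by (metis UNIV_I)
  have "(\<lambda>k. g ((r \<circ> q) k) i) \<longlonglongrightarrow> (l(C := p)) i" if "i < Suc C" for i
    using that p LIMSEQ_subseq_LIMSEQ[OF l q, of i]
    by (cases "i = C") (auto simp: o_def less_Suc_eq)
  moreover have "strict_mono (r \<circ> q)"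
    using r q by (rule strict_mono_o)
  ultimately show ?case by blast
qed

text \<open>The distance attains its minimum on the compact product, and disjointness makes that
  minimum positive.\<close>

lemma compact_disjoint_dist_ge:
  fixes S :: "'a::metric_space set"
  assumes "compact S" "compact S'" "S \<inter> S' = {}"
  shows "\<exists>d>0. \<forall>x\<in>S. \<forall>y\<in>S'. d \<le> dist x y"
proof (cases "S \<times> S' = {}")
  case True
  thus ?thesis by (auto intro: exI[of _ 1])
next
  case False
  have "continuous_on (S \<times> S') (\<lambda>p. dist (fst p) (snd p))"
    by (intro continuous_intros)
  from continuous_attains_inf[OF compact_Times[OF assms(1,2)] False this]
  obtain p where p: "p \<in> S \<times> S'"
    "\<forall>q\<in>S \<times> S'. dist (fst p) (snd p) \<le> dist (fst q) (snd q)"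
    by (elim bexE)
  with assms(3) have "fst p \<noteq> snd p" by auto
  with p(2) show ?thesis by (intro exI[of _ "dist (fst p) (snd p)"]) auto
qed

text \<open>A point that eventually leaves each of the finitely many decreasing chains has left all
  of them by the largest of its exit times.\<close>

lemma Inter_finite_Union_decseq:
  fixes E :: "nat \<Rightarrow> 'i \<Rightarrow> 'b set"
  assumes "finite I" and decseq: "\<And>i. decseq (\<lambda>n. E n i)"
  shows "(\<Inter>n. \<Union>i\<in>I. E n i) = (\<Union>i\<in>I. \<Inter>n. E n i)"
proof (intro equalityI subsetI)
  fix y assume y: "y \<in> (\<Inter>n. \<Union>i\<in>I. E n i)"
  show "y \<in> (\<Union>i\<in>I. \<Inter>n. E n i)"
  proof (rule ccontr)
    assume "\<not> ?thesis"
    hence "\<forall>i\<in>I. \<exists>n. y \<notin> E n i" by simp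
    then obtain n where n: "\<forall>i\<in>I. y \<notin> E (n i) i" by (rule bchoice[THEN exE])
    obtain i where i: "i \<in> I" "y \<in> E (Max (n ` I)) i" using y by auto
    have "n i \<le> Max (n ` I)" using i(1) assms(1) by simp
    hence "y \<in> E (n i) i" using i(2) decseqD[OF decseq] by blast
    with n i(1) show False by simp
  qed
qed auto

section \<open>Arithmetic of the strip\<close>

lemma strip_iff:
  "w \<in> strip \<beta> b \<longleftrightarrow> \<bar>real_of_int (snd w) - \<beta> * real_of_int (fst w)\<bar> \<le> b"
  by (auto simp: strip_def abs_le_iff split: prod.splits)

text \<open>The signed height \<open>s\<close> above the line of slope \<beta> is additive, and the
  strip is where its absolute value is at most \<open>b\<close>. A sum of two strip vectors has
  height at most \<open>2 * b\<close> in absolute value, so boundedly many steps along one fixed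
  strip vector bring it back.\<close>

lemma strip_recentre:
  assumes "b > 0"
  shows "\<exists>U. finite U \<and> (\<forall>w\<in>strip \<beta> b. \<forall>z\<in>strip \<beta> b. \<exists>u\<in>U. w + z + u \<in> strip \<beta> b)"
proof -
  define s where "s w = real_of_int (snd w) - \<beta> * real_of_int (fst w)" for w :: "int \<times> int"
  have strip: "w \<in> strip \<beta> b \<longleftrightarrow> \<bar>s w\<bar> \<le> b" for w
    by (simp add: strip_iff s_def)
  have add: "s (v + w) = s v + s w" for v w
    by (simp add: s_def algebra_simps)
  show ?thesis
  proof (cases "\<exists>v. 0 < s v \<and> s v \<le> b")
    case True
    then obtain v where v: "0 < s v" "s v \<le> b" by blast
    \<comment> \<open>The corrections are multiples of \<open>v\<close>. The range of
      \<open>t\<close> is dictated by the height \<open>2 * b\<close> to be undone, measured in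
      units of \<open>s v\<close>.\<close>
    define U where "U = (\<lambda>t. (t * fst v, t * snd v)) ` {-\<lceil>2 * b / s v\<rceil>..\<lceil>2 * b / s v\<rceil>}"
    have "\<exists>u\<in>U. w + z + u \<in> strip \<beta> b" if "w \<in> strip \<beta> b" "z \<in> strip \<beta> b" for w z
    proof -
      define r where "r = s (w + z) / s v"
      define u where "u = (- \<lfloor>r\<rfloor> * fst v, - \<lfloor>r\<rfloor> * snd v)"
      have "\<bar>s (w + z)\<bar> \<le> 2 * b"
        using that by (auto simp: strip add)
      hence "\<bar>r\<bar> \<le> 2 * b / s v"
        using v by (simp add: r_def abs_divide divide_right_mono)
      hence "- \<lceil>2 * b / s v\<rceil> \<le> \<lfloor>r\<rfloor>" "\<lfloor>r\<rfloor> \<le> \<lceil>2 * b / s v\<rceil>"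
        by linarith+
      hence u: "u \<in> U"
        unfolding u_def U_def by (intro image_eqI[of _ _ "- \<lfloor>r\<rfloor>"]) auto
      \<comment> \<open>Subtracting the integer part of \<open>r\<close> leaves a height between
        \<open>0\<close> and \<open>s v\<close>, hence at most \<open>b\<close>.\<close>
      have "s (w + z + u) = frac r * s v"
        using v by (simp add: add[of "w + z"] frac_def r_def s_def[of u])
          (simp add: u_def r_def s_def field_simps)
      moreover have "0 \<le> frac r * s v" "frac r * s v \<le> s v"
        using v frac_lt_1[of r] by (auto simp: mult_le_cancel_right1)
      ultimately have "\<bar>s (w + z + u)\<bar> \<le> b"
        using v by linarith
      with u show ?thesis by (auto simp: strip)
    qed
    moreover have "finite U" by (simp add: U_def)
    ultimately show ?thesis by blast
  next
    case False
    \<comment> \<open>A strip vector of nonzero height, or its negative, would be the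
      \<open>v\<close> of the other case. With all heights zero the strip is closed under
      addition.\<close>
    have zero: "s w = 0" if "w \<in> strip \<beta> b" for w
    proof -
      have "s (- w) = - s w" by (simp add: s_def)
      moreover have "\<not> (0 < s w \<and> s w \<le> b)" "\<not> (0 < s (- w) \<and> s (- w) \<le> b)"
        using False by blast+
      ultimately show ?thesis using that unfolding strip by linarith
    qed
    have "w + z + 0 \<in> strip \<beta> b" if "w \<in> strip \<beta> b" "z \<in> strip \<beta> b" for w z
      using that[THEN zero] assms by (simp add: strip add)
    then show ?thesis by (intro exI[of _ "{0}"]) simp
  qed
qed

text \<open>Dirichlet approximation gives a vector \<open>(k, h)\<close> with \<open>k > 0\<close>
  and height below \<open>1 / N\<close>. As \<open>N > t / b\<close>, its multiple by
  \<open>t\<close> still has height at most \<open>b\<close>, and its first coordinate is at least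
  \<open>t\<close>.\<close>

lemma strip_unbounded:
  assumes "b > 0"
  shows "\<exists>z\<in>strip \<beta> b. int t \<le> fst z"
proof -
  obtain N :: nat where N: "real t / b < real N"
    using reals_Archimedean2 by blast
  have "0 \<le> real t / b" using assms by simp
  with N have "N > 0" by linarith
  then obtain h k where k: "0 < k" "\<bar>of_int k * \<beta> - of_int h\<bar> < 1 / real N"
    using Dirichlet_approx[of N \<beta>] by metis
  have "real t * \<bar>of_int k * \<beta> - of_int h\<bar> \<le> real t * (1 / real N)"
    using k by (intro mult_left_mono) auto
  also have "\<dots> \<le> b"
    using N assms \<open>N > 0\<close> by (simp add: field_simps)
  finally have "\<bar>real t * (of_int k * \<beta> - of_int h)\<bar> \<le> b"
    by (simp add: abs_mult)
  hence "(int t * k, int t * h) \<in> strip \<beta> b"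
    unfolding strip_iff by (simp add: algebra_simps abs_minus_commute)
  moreover have "int t \<le> int t * k"
    using k by (simp add: mult_le_cancel_left1)
  ultimately show ?thesis by (metis fst_conv)
qed

section \<open>Dynamical balls and limits of their centres\<close>

lemma dyn_dist_less_iff:
  assumes "b > 0" "k \<ge> 1"
  shows "dyn_dist T \<beta> b k x y < \<epsilon> \<longleftrightarrow> (\<forall>w\<in>strip_upto \<beta> b k. dist (T w x) (T w y) < \<epsilon>)"
  unfolding dyn_dist_def
  using finite_strip_upto[of \<beta> b k] zero_in_strip_upto[OF assms, of \<beta>]
  by (subst Max_less_iff) auto

lemma open_dyn_ball:
  assumes "b > 0" "k \<ge> 1" "\<And>w. continuous_on UNIV (T w)"
  shows "open (dyn_ball T \<beta> b k x \<epsilon>)"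
proof -
  have "dyn_ball T \<beta> b k x \<epsilon> = (\<Inter>w\<in>strip_upto \<beta> b k. {y. dist (T w x) (T w y) < \<epsilon>})"
    using assms by (auto simp: dyn_ball_def dyn_dist_less_iff)
  moreover have "open {y. dist (T w x) (T w y) < \<epsilon>}" for w
    by (intro open_Collect_less continuous_intros assms)
  ultimately show ?thesis
    by (simp add: open_INT finite_strip_upto)
qed

text \<open>
  Limit points of the centres for the windows \<open>W k\<close> serve as centres for all windows at once,
  at the cost of doubling the radius.
\<close>

lemma uniform_centres:
  fixes f :: "'w \<Rightarrow> 'a::metric_space \<Rightarrow> 'a"
  assumes "finite_measure \<mu>" and sets: "sets \<mu> = sets borel"
    and "compact (UNIV :: 'a set)"
    and cont: "\<And>w. continuous_on UNIV (f w)"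
    and fin: "\<And>k::nat. finite (W k)" and mono: "mono W" and "\<epsilon> > 0"
    and cover: "\<And>k. \<exists>F. finite F \<and> card F \<le> C \<and>
           measure \<mu> (\<Union>x\<in>F. {y. \<forall>w\<in>W k. dist (f w x) (f w y) < \<epsilon>}) \<ge> c"
  shows "\<exists>l. measure \<mu> (\<Union>i<C. {y. \<forall>w\<in>(\<Union>k. W k). dist (f w (l i)) (f w y) \<le> 2 * \<epsilon>}) \<ge> c"
proof -
  interpret finite_measure \<mu> by fact
  have "\<exists>g. measure \<mu> (\<Union>i<C. {y. \<forall>w\<in>W k. dist (f w (g i)) (f w y) < \<epsilon>}) \<ge> c" for k
  proof -
    obtain F where F: "finite F" "card F \<le> C"
      "measure \<mu> (\<Union>x\<in>F. {y. \<forall>w\<in>W k. dist (f w x) (f w y) < \<epsilon>}) \<ge> c"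
      using cover by blast
    \<comment> \<open>Centres are indexed by the fixed set of \<open>i < C\<close>, so that limits
      can be taken index by index. Values of \<open>h\<close> beyond \<open>card F\<close> can only
      enlarge the union.\<close>
    obtain h where "bij_betw h {0..<card F} F"
      using F(1) ex_bij_betw_nat_finite by blast
    hence "h ` {0..<card F} = F" by (rule bij_betw_imp_surj_on)
    moreover have "{0..<card F} \<subseteq> {..<C}" using F(2) by auto
    ultimately have "F \<subseteq> h ` {..<C}" by blast
    moreover have "open {y. \<forall>w\<in>W k. dist (f w x) (f w y) < \<epsilon>}" for x
    proof -
      have "{y. \<forall>w\<in>W k. dist (f w x) (f w y) < \<epsilon>} = (\<Inter>w\<in>W k. {y. dist (f w x) (f w y) < \<epsilon>})"
        by auto
      moreover have "open {y. dist (f w x) (f w y) < \<epsilon>}" for w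
        by (intro open_Collect_less continuous_intros cont)
      ultimately show ?thesis by (simp add: open_INT fin)
    qed
    ultimately have "measure \<mu> (\<Union>x\<in>F. {y. \<forall>w\<in>W k. dist (f w x) (f w y) < \<epsilon>})
        \<le> measure \<mu> (\<Union>i<C. {y. \<forall>w\<in>W k. dist (f w (h i)) (f w y) < \<epsilon>})"
      by (intro finite_measure_mono) (auto simp: sets)
    with F(3) show ?thesis by (intro exI[of _ h]) linarith
  qed
  then obtain g where g: "\<And>k. measure \<mu> (\<Union>i<C. {y. \<forall>w\<in>W k. dist (f w (g k i)) (f w y) < \<epsilon>}) \<ge> c"
    using choice[of "\<lambda>k g. measure \<mu> (\<Union>i<C. {y. \<forall>w\<in>W k. dist (f w (g i)) (f w y) < \<epsilon>}) \<ge> c"]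
    by auto
  obtain r l where r: "strict_mono (r :: nat \<Rightarrow> nat)"
    and l: "\<And>i. i < C \<Longrightarrow> (\<lambda>k. g (r k) i) \<longlonglongrightarrow> l i"
    using compact_convergent_subseq_family[OF assms(3), of C g] by blast
  define E where "E n i = {y. \<forall>w\<in>W n. dist (f w (l i)) (f w y) \<le> 2 * \<epsilon>}" for n i
  have closed: "closed (E n i)" for n i
  proof -
    have "E n i = (\<Inter>w\<in>W n. {y. dist (f w (l i)) (f w y) \<le> 2 * \<epsilon>})"
      by (auto simp: E_def)
    moreover have "closed {y. dist (f w (l i)) (f w y) \<le> 2 * \<epsilon>}" for w
      by (intro closed_Collect_le continuous_intros cont)
    ultimately show ?thesis by auto
  qed
  have meas: "(\<Union>i<C. E n i) \<in> sets \<mu>" for n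
    using closed by (auto simp: sets intro!: sets.finite_UN)
  have lower: "c \<le> measure \<mu> (\<Union>i<C. E n i)" for n
  proof -
    \<comment> \<open>Convergence at each single \<open>i\<close> and \<open>w\<close> becomes
      simultaneous because \<open>W n\<close> and the index set are finite.\<close>
    have "\<forall>\<^sub>F k in sequentially. dist (f w (g (r k) i)) (f w (l i)) < \<epsilon>" if "i < C" for i w
    proof -
      have "(\<lambda>k. f w (g (r k) i)) \<longlonglongrightarrow> f w (l i)"
        using cont[of w] l[OF that]
        by (auto simp: continuous_on_eq_continuous_at intro: isCont_tendsto_compose)
      thus ?thesis using \<open>\<epsilon> > 0\<close> by (auto dest: tendstoD)
    qed
    hence "\<forall>\<^sub>F k in sequentially. \<forall>i\<in>{..<C}. \<forall>w\<in>W n. dist (f w (g (r k) i)) (f w (l i)) < \<epsilon>"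
      using fin by (intro eventually_ball_finite ballI) auto
    hence "\<forall>\<^sub>F k in sequentially. k \<ge> n \<and>
        (\<forall>i\<in>{..<C}. \<forall>w\<in>W n. dist (f w (g (r k) i)) (f w (l i)) < \<epsilon>)"
      by (intro eventually_conj eventually_ge_at_top)
    then obtain k where k: "k \<ge> n"
      "\<And>i w. i < C \<Longrightarrow> w \<in> W n \<Longrightarrow> dist (f w (g (r k) i)) (f w (l i)) < \<epsilon>"
      using eventually_happens'[OF sequentially_bot] by fastforce
    \<comment> \<open>The window of the late stage contains \<open>W n\<close>, so its cells already
      control every \<open>w\<close> in \<open>W n\<close>; the triangle inequality then replaces
      its centre by \<open>l i\<close>.\<close>
    have "n \<le> r k" using k(1) seq_suble[OF r, of k] by linarith
    hence "W n \<subseteq> W (r k)" using mono by (simp add: monoD)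
    hence "(\<Union>i<C. {y. \<forall>w\<in>W (r k). dist (f w (g (r k) i)) (f w y) < \<epsilon>}) \<subseteq> (\<Union>i<C. E n i)"
    proof (intro UN_mono subset_refl subsetI)
      fix i y assume i: "i \<in> {..<C}"
        and y: "y \<in> {y. \<forall>w\<in>W (r k). dist (f w (g (r k) i)) (f w y) < \<epsilon>}"
      show "y \<in> E n i"
        unfolding E_def
      proof (intro CollectI ballI)
        fix w assume "w \<in> W n"
        with \<open>W n \<subseteq> W (r k)\<close> y i k(2)[of i w]
        have "dist (f w (g (r k) i)) (f w y) < \<epsilon>" "dist (f w (g (r k) i)) (f w (l i)) < \<epsilon>"
          by auto
        thus "dist (f w (l i)) (f w y) \<le> 2 * \<epsilon>"
          using dist_triangle3[of "f w (l i)" "f w y" "f w (g (r k) i)"] by linarith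
      qed
    qed
    hence "measure \<mu> (\<Union>i<C. {y. \<forall>w\<in>W (r k). dist (f w (g (r k) i)) (f w y) < \<epsilon>})
        \<le> measure \<mu> (\<Union>i<C. E n i)"
      using meas by (rule finite_measure_mono)
    with g[of "r k"] show ?thesis by linarith
  qed
  \<comment> \<open>Continuity from above carries the lower bound \<open>c\<close> to the
    intersection. Exchanging intersection and union then gives one centre valid for all
    windows.\<close>
  have "decseq (\<lambda>n. \<Union>i<C. E n i)"
    unfolding decseq_def E_def using monoD[OF mono] by blast
  hence "(\<lambda>n. measure \<mu> (\<Union>i<C. E n i)) \<longlonglongrightarrow> measure \<mu> (\<Inter>n. \<Union>i<C. E n i)"
    using meas by (intro finite_Lim_measure_decseq) auto
  hence "c \<le> measure \<mu> (\<Inter>n. \<Union>i<C. E n i)"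
    using lower by (intro LIMSEQ_le_const) auto
  also have "(\<Inter>n. \<Union>i<C. E n i) = (\<Union>i<C. \<Inter>n. E n i)"
    by (rule Inter_finite_Union_decseq) (auto simp: decseq_def E_def dest: monoD[OF mono])
  also have "\<dots> = (\<Union>i<C. {y. \<forall>w\<in>(\<Union>k. W k). dist (f w (l i)) (f w y) \<le> 2 * \<epsilon>})"
    unfolding E_def by auto
  finally show ?thesis by (rule exI[of _ l])
qed

section \<open>The system and its invariant measure\<close>

locale Z2_system =
  fixes T :: "int \<times> int \<Rightarrow> 'a::metric_space \<Rightarrow> 'a" and \<mu> :: "'a measure" and \<beta> b :: real
  assumes tds: "Z2_tds T" and inv: "\<mu> \<in> invariant_measures T" and b_pos: "b > 0"
begin

sublocale prob_space \<mu>
  using inv by (simp add: invariant_measures_def)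

lemma sets_eq: "sets \<mu> = sets borel"
  using inv by (simp add: invariant_measures_def)

lemma compact_UNIV: "compact (UNIV :: 'a set)"
  using tds by (simp add: Z2_tds_def)

lemma continuous: "continuous_on UNIV (T w)"
  using tds unfolding Z2_tds_def by (meson homeomorphism_cont1)

lemma T_add: "T (v + w) x = T v (T w x)"
  using tds unfolding Z2_tds_def by (metis comp_apply)

text \<open>\<open>T 0\<close> is idempotent and onto.\<close>

lemma T_zero: "T 0 x = x"
proof -
  have "surj (T 0)"
    using tds unfolding Z2_tds_def by (meson homeomorphism_image1)
  then obtain y where "x = T 0 y" by blast
  thus ?thesis using T_add[of 0 0 y] by simp
qed

text \<open>Invariance is assumed for images under \<open>T (- w)\<close>, and \<open>- w\<close>
  runs over the whole group.\<close>

lemma measure_image: "A \<in> sets borel \<Longrightarrow> measure \<mu> (T w ` A) = measure \<mu> A"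
  using inv unfolding invariant_measures_def by (metis (mono_tags, lifting) mem_Collect_eq minus_minus)

section \<open>Uniform continuity and two-sided windows\<close>

lemma equicontinuous_finite:
  assumes "finite U" "\<epsilon> > 0"
  shows "\<exists>\<delta>>0. \<forall>u\<in>U. \<forall>x y. dist x y < \<delta> \<longrightarrow> dist (T u x) (T u y) < \<epsilon>"
proof (rule finite_uniform_dist[OF assms(1)])
  fix u
  have "uniformly_continuous_on UNIV (T u)"
    using continuous compact_UNIV by (rule compact_uniformly_continuous)
  thus "\<exists>d>0. \<forall>x y. dist x y < d \<longrightarrow> dist (T u x) (T u y) < \<epsilon>"
    unfolding uniformly_continuous_on_def using assms(2) by (metis UNIV_I dist_commute)
qed

text \<open>
  Moving the centres along a vector of the strip turns one-sided windows into two-sided ones.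
  Such a translation does not preserve the strip, but it does so up to a finite set of corrections,
  which uniform continuity absorbs.
\<close>

lemma two_sided_complexity:
  assumes "bounded_complexity T \<mu> \<beta> b" "\<epsilon> > 0"
  shows "\<exists>C. \<forall>k::nat. \<exists>F. finite F \<and> card F \<le> C \<and> 1 - \<epsilon> \<le> measure \<mu>
    (\<Union>x\<in>F. {y. \<forall>w\<in>strip \<beta> b \<inter> {-int k..int k} \<times> {-int k..int k}. dist (T w x) (T w y) < \<epsilon>})"
proof -
  obtain U where U: "finite U"
    "\<And>w z. w \<in> strip \<beta> b \<Longrightarrow> z \<in> strip \<beta> b \<Longrightarrow> \<exists>u\<in>U. w + z + u \<in> strip \<beta> b"
    using strip_recentre[OF b_pos, of \<beta>] by blast
  obtain \<delta> where \<delta>: "\<delta> > 0"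
    "\<And>u x y. u \<in> U \<Longrightarrow> dist x y < \<delta> \<Longrightarrow> dist (T (- u) x) (T (- u) y) < \<epsilon>"
    using equicontinuous_finite[of "uminus ` U" \<epsilon>] U(1) assms(2) by auto
  \<comment> \<open>\<open>R\<close> bounds the horizontal shift of every correction; inserting
    \<open>0\<close> makes the maximum meaningful even for empty \<open>U\<close>.\<close>
  define R where "R = nat (Max (insert 0 ((\<lambda>u. \<bar>fst u\<bar>) ` U)))"
  have R: "\<bar>fst u\<bar> \<le> int R" if "u \<in> U" for u
    using that U(1) unfolding R_def by simp
  \<comment> \<open>The bound \<delta> allows a correction to be undone within \<epsilon>, and the
    bound \<epsilon> turns \<open>1 - \<eta>\<close> into at least
    \<open>1 - \<epsilon>\<close>.\<close>
  define \<eta> where "\<eta> = min \<delta> \<epsilon>"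
  have "\<eta> > 0" using \<delta> assms by (simp add: \<eta>_def)
  then obtain C where C: "\<And>k. k \<ge> 1 \<Longrightarrow> \<exists>F. finite F \<and> card F \<le> C \<and>
      measure \<mu> (\<Union>x\<in>F. dyn_ball T \<beta> b k x \<eta>) > 1 - \<eta>"
    using assms(1) unfolding bounded_complexity_def by blast
  have "\<exists>F. finite F \<and> card F \<le> C \<and> 1 - \<epsilon> \<le> measure \<mu>
    (\<Union>x\<in>F. {y. \<forall>w\<in>strip \<beta> b \<inter> {-int k..int k} \<times> {-int k..int k}. dist (T w x) (T w y) < \<epsilon>})" for k
  proof -
    let ?D = "\<lambda>x. {y. \<forall>w\<in>strip \<beta> b \<inter> {-int k..int k} \<times> {-int k..int k}. dist (T w x) (T w y) < \<epsilon>}"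
    obtain z where z: "z \<in> strip \<beta> b" "int (k + R) \<le> fst z"
      using strip_unbounded[OF b_pos] by blast
    \<comment> \<open>For a first coordinate between \<open>- k\<close> and \<open>k\<close>, adding
      \<open>z\<close> and a correction lands between \<open>0\<close> and \<open>2 * fst z\<close>.
      The extra \<open>1\<close> is there because \<open>strip_upto\<close> excludes its right
      end.\<close>
    define n where "n = nat (2 * fst z) + 1"
    have "n \<ge> 1" by (simp add: n_def)
    then obtain F where F: "finite F" "card F \<le> C"
      "measure \<mu> (\<Union>x\<in>F. dyn_ball T \<beta> b n x \<eta>) > 1 - \<eta>"
      using C by blast
    have "T z ` dyn_ball T \<beta> b n x \<eta> \<subseteq> ?D (T z x)" for x
    proof clarify
      fix y v1 v2 assume y: "y \<in> dyn_ball T \<beta> b n x \<eta>"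
        and w: "(v1, v2) \<in> strip \<beta> b" "v1 \<in> {-int k..int k}"
      obtain u where u: "u \<in> U" "(v1, v2) + z + u \<in> strip \<beta> b" using U(2) w(1) z(1) by blast
      let ?v = "(v1, v2) + z + u"
      have "?v \<in> strip_upto \<beta> b n"
        using u w z R[OF u(1)] by (auto simp: strip_upto_def n_def mem_Times_iff)
      hence "dist (T ?v x) (T ?v y) < \<delta>"
        using y \<open>n \<ge> 1\<close> b_pos by (simp add: dyn_ball_def dyn_dist_less_iff \<eta>_def)
      \<comment> \<open>Applying \<open>T (- u)\<close> removes the correction: what remains of
        \<open>T ?v\<close> is \<open>T (v1, v2)\<close> after \<open>T z\<close>.\<close>
      hence "dist (T (- u) (T ?v x)) (T (- u) (T ?v y)) < \<epsilon>"
        using \<delta>(2) u(1) by blast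
      thus "dist (T (v1, v2) (T z x)) (T (v1, v2) (T z y)) < \<epsilon>"
        by (simp flip: T_add)
    qed
    hence sub: "T z ` (\<Union>x\<in>F. dyn_ball T \<beta> b n x \<eta>) \<subseteq> (\<Union>x\<in>T z ` F. ?D x)"
      by blast
    have openD: "open (?D x)" for x
    proof -
      have "?D x = (\<Inter>w\<in>strip \<beta> b \<inter> {-int k..int k} \<times> {-int k..int k}. {y. dist (T w x) (T w y) < \<epsilon>})"
        by auto
      moreover have "open {y. dist (T w x) (T w y) < \<epsilon>}" for w
        by (intro open_Collect_less continuous_intros continuous)
      ultimately show ?thesis by (simp add: open_INT)
    qed
    have "1 - \<epsilon> \<le> measure \<mu> (\<Union>x\<in>F. dyn_ball T \<beta> b n x \<eta>)"
      using F(3) by (simp add: \<eta>_def)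
    also have "\<dots> = measure \<mu> (T z ` (\<Union>x\<in>F. dyn_ball T \<beta> b n x \<eta>))"
      using \<open>n \<ge> 1\<close> b_pos continuous by (intro measure_image[symmetric] borel_open open_UN ballI open_dyn_ball)
    also have "\<dots> \<le> measure \<mu> (\<Union>x\<in>T z ` F. ?D x)"
      using sub unfolding sets_eq
      by (rule finite_measure_mono) (unfold sets_eq, intro borel_open open_UN ballI openD)
    finally show ?thesis
      using F(1,2) card_image_le[OF F(1), of "T z"] by (intro exI[of _ "T z ` F"]) auto
  qed
  thus ?thesis by blast
qed

section \<open>Closed cells of the strip metric\<close>

text \<open>This is the closed ball for the supremum of the distances over the whole strip. The weak
  inequality makes it closed, hence compact, in the original topology.\<close>

definition strip_cell :: "'a \<Rightarrow> real \<Rightarrow> 'a set" where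
  "strip_cell x r = {y. \<forall>w\<in>strip \<beta> b. dist (T w x) (T w y) \<le> r}"

lemma closed_strip_cell: "closed (strip_cell x r)"
proof -
  have "strip_cell x r = (\<Inter>w\<in>strip \<beta> b. {y. dist (T w x) (T w y) \<le> r})"
    by (auto simp: strip_cell_def)
  moreover have "closed {y. dist (T w x) (T w y) \<le> r}" for w
    by (intro closed_Collect_le continuous_intros continuous)
  ultimately show ?thesis by auto
qed

text \<open>The two-sided windows \<open>W k\<close> increase to the strip and have a common bound
  \<open>C\<close> on the number of centres, so \<open>uniform_centres\<close> applies to
  them.\<close>

lemma strip_cell_cover:
  assumes "bounded_complexity T \<mu> \<beta> b" "\<epsilon> > 0"
  shows "\<exists>F. finite F \<and> measure \<mu> (\<Union>x\<in>F. strip_cell x (2 * \<epsilon>)) \<ge> 1 - \<epsilon>"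
proof -
  define W where "W k = strip \<beta> b \<inter> {-int k..int k} \<times> {-int k..int k}" for k :: nat
  have UN: "(\<Union>k. W k) = strip \<beta> b"
  proof -
    have "w \<in> (\<Union>k. W k)" if "w \<in> strip \<beta> b" for w
      using that by (intro UN_I[of "nat (max \<bar>fst w\<bar> \<bar>snd w\<bar>)"]) (auto simp: W_def mem_Times_iff)
    thus ?thesis by (auto simp: W_def)
  qed
  have "\<exists>C. \<forall>k. \<exists>F. finite F \<and> card F \<le> C \<and>
      1 - \<epsilon> \<le> measure \<mu> (\<Union>x\<in>F. {y. \<forall>w\<in>W k. dist (T w x) (T w y) < \<epsilon>})"
    using two_sided_complexity[OF assms] by (simp only: W_def)
  then obtain C where C: "\<forall>k. \<exists>F. finite F \<and> card F \<le> C \<and>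
      1 - \<epsilon> \<le> measure \<mu> (\<Union>x\<in>F. {y. \<forall>w\<in>W k. dist (T w x) (T w y) < \<epsilon>})"
    by (rule exE)
  have "mono W" by (force simp: W_def mono_def)
  have "\<exists>l. measure \<mu> (\<Union>i<C. {y. \<forall>w\<in>(\<Union>k. W k). dist (T w (l i)) (T w y) \<le> 2 * \<epsilon>}) \<ge> 1 - \<epsilon>"
    by (rule uniform_centres[OF finite_measure_axioms sets_eq compact_UNIV continuous _ \<open>mono W\<close> assms(2)
          C[rule_format]]) (simp add: W_def)
  then obtain l where
    "measure \<mu> (\<Union>i<C. {y. \<forall>w\<in>(\<Union>k. W k). dist (T w (l i)) (T w y) \<le> 2 * \<epsilon>}) \<ge> 1 - \<epsilon>"
    by (rule exE)
  thus ?thesis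
    by (intro exI[of _ "l ` {..<C}"]) (simp add: UN strip_cell_def)
qed

text \<open>
  Two cells that meet contain only points at strip distance at most \<open>4 * r\<close>;
  two cells that do not meet are a positive distance apart.
\<close>

lemma equicontinuous_on_cells:
  assumes "finite F" "4 * r < \<epsilon>"
  shows "\<exists>\<delta>>0. \<forall>x\<in>(\<Union>p\<in>F. strip_cell p r). \<forall>y\<in>(\<Union>p\<in>F. strip_cell p r).
    dist x y < \<delta> \<longrightarrow> (\<forall>w\<in>strip \<beta> b. dist (T w x) (T w y) < \<epsilon>)"
proof -
  have "\<exists>\<delta>>0. \<forall>p\<in>F \<times> F. \<forall>x y. dist x y < \<delta> \<longrightarrow> x \<in> strip_cell (fst p) r \<longrightarrow>
    y \<in> strip_cell (snd p) r \<longrightarrow> (\<forall>w\<in>strip \<beta> b. dist (T w x) (T w y) < \<epsilon>)"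
  proof (rule finite_uniform_dist)
    fix p :: "'a \<times> 'a"
    show "\<exists>\<delta>>0. \<forall>x y. dist x y < \<delta> \<longrightarrow> x \<in> strip_cell (fst p) r \<longrightarrow>
      y \<in> strip_cell (snd p) r \<longrightarrow> (\<forall>w\<in>strip \<beta> b. dist (T w x) (T w y) < \<epsilon>)"
    proof (cases "strip_cell (fst p) r \<inter> strip_cell (snd p) r = {}")
      case True
      have "compact (strip_cell x r)" for x
        using compact_Int_closed[OF compact_UNIV closed_strip_cell] by simp
      then obtain d where d: "d > 0"
        "\<And>x y. x \<in> strip_cell (fst p) r \<Longrightarrow> y \<in> strip_cell (snd p) r \<Longrightarrow> d \<le> dist x y"
        using compact_disjoint_dist_ge[OF _ _ True] by blast
      have "\<not> dist x y < d" if "x \<in> strip_cell (fst p) r" "y \<in> strip_cell (snd p) r" for x y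
        using d(2)[OF that] by simp
      with d(1) show ?thesis by blast
    next
      case False
      then obtain q where q: "q \<in> strip_cell (fst p) r" "q \<in> strip_cell (snd p) r" by blast
      have "dist (T w x) (T w y) < \<epsilon>"
        if "x \<in> strip_cell (fst p) r" "y \<in> strip_cell (snd p) r" "w \<in> strip \<beta> b" for x y w
      proof -
        have *: "dist (T w (fst p)) (T w x) \<le> r" "dist (T w (fst p)) (T w q) \<le> r"
          "dist (T w (snd p)) (T w q) \<le> r" "dist (T w (snd p)) (T w y) \<le> r"
          using that q by (auto simp: strip_cell_def)
        have "dist (T w x) (T w y) \<le> dist (T w x) (T w q) + dist (T w q) (T w y)"
          by (rule dist_triangle)
        moreover have "dist (T w x) (T w q) \<le> 2 * r"
          using * dist_triangle3[of "T w x" "T w q" "T w (fst p)"] by linarith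
        moreover have "dist (T w q) (T w y) \<le> 2 * r"
          using * dist_triangle3[of "T w q" "T w y" "T w (snd p)"] by linarith
        ultimately show ?thesis using assms(2) by linarith
      qed
      thus ?thesis by (intro exI[of _ 1]) auto
    qed
  qed (use assms in auto)
  then obtain \<delta> where \<delta>: "\<delta> > 0" "\<forall>p\<in>F \<times> F. \<forall>x y. dist x y < \<delta> \<longrightarrow> x \<in> strip_cell (fst p) r \<longrightarrow>
    y \<in> strip_cell (snd p) r \<longrightarrow> (\<forall>w\<in>strip \<beta> b. dist (T w x) (T w y) < \<epsilon>)"
    by (elim exE conjE)
  have "\<forall>w\<in>strip \<beta> b. dist (T w x) (T w y) < \<epsilon>"
    if xy: "x \<in> (\<Union>p\<in>F. strip_cell p r)" "y \<in> (\<Union>p\<in>F. strip_cell p r)" "dist x y < \<delta>" for x y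
  proof -
    obtain p q where "p \<in> F" "q \<in> F" "x \<in> strip_cell p r" "y \<in> strip_cell q r"
      using xy(1,2) by auto
    with \<delta>(2)[THEN bspec, of "(p, q)"] xy(3) show ?thesis by simp
  qed
  with \<delta>(1) show ?thesis by blast
qed

section \<open>The two implications\<close>

text \<open>The sets missed by the covers at scales \<open>e n\<close> have small total measure.
  What lies in every cover inherits, for each \<epsilon>, the modulus of a single sufficiently fine
  cover.\<close>

lemma bounded_complexity_imp_equicontinuous:
  assumes "bounded_complexity T \<mu> \<beta> b"
  shows "measure_equicontinuous T \<mu> \<beta> b"
  unfolding measure_equicontinuous_def
proof (intro allI impI)
  fix \<tau> :: real assume "\<tau> > 0"
  \<comment> \<open>The sum is \<open>\<tau> / 2\<close> rather than \<tau>, which leaves room for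
    the strict inequality \<open>> 1 - \<tau>\<close>.\<close>
  define e where "e n = \<tau> / 2 * (1 / 2) ^ Suc n" for n
  have "e n > 0" for n using \<open>\<tau> > 0\<close> by (simp add: e_def)
  hence "\<forall>n. \<exists>F. finite F \<and> measure \<mu> (\<Union>x\<in>F. strip_cell x (2 * e n)) \<ge> 1 - e n"
    using strip_cell_cover[OF assms] by (intro allI) simp
  then obtain F where "\<forall>n. finite (F n) \<and>
      measure \<mu> (\<Union>x\<in>F n. strip_cell x (2 * e n)) \<ge> 1 - e n"
    by (rule choice[THEN exE])
  hence F: "\<And>n. finite (F n)"
    "\<And>n. measure \<mu> (\<Union>x\<in>F n. strip_cell x (2 * e n)) \<ge> 1 - e n"
    by simp_all
  define A where "A n = (\<Union>x\<in>F n. strip_cell x (2 * e n))" for n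
  have A: "A n \<in> sets \<mu>" for n
    using F(1) closed_strip_cell by (auto simp: A_def sets_eq intro!: borel_closed closed_UN)
  have space: "space \<mu> = UNIV" using sets_eq by (metis sets_eq_imp_space_eq space_borel)
  have "e sums (\<tau> / 2)"
    unfolding e_def using sums_mult[OF power_half_series, of "\<tau> / 2"] by simp
  have le: "measure \<mu> (- A n) \<le> e n" for n
    using prob_compl[OF A[of n]] F(2)[of n, folded A_def]
    by (simp add: space flip: Compl_eq_Diff_UNIV)
  have summable: "summable (\<lambda>n. measure \<mu> (- A n))"
    by (rule summable_comparison_test'[OF sums_summable[OF \<open>e sums (\<tau> / 2)\<close>], of 0])
      (simp add: le)
  have meas: "(\<Inter>n. A n) \<in> sets \<mu>" using A by auto
  have Compl: "- A n \<in> sets \<mu>" for n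
    using A[of n] by (metis Compl_eq_Diff_UNIV sets.compl_sets space)
  have "1 - measure \<mu> (\<Inter>n. A n) = measure \<mu> (\<Union>n. - A n)"
    using prob_compl[OF meas] by (simp add: space flip: Compl_eq_Diff_UNIV)
  also have "\<dots> \<le> (\<Sum>n. measure \<mu> (- A n))"
    using Compl summable by (intro finite_measure_subadditive_countably) auto
  also have "\<dots> \<le> (\<Sum>n. e n)"
    by (rule suminf_le[OF le summable sums_summable[OF \<open>e sums (\<tau> / 2)\<close>]])
  also have "\<dots> = \<tau> / 2" using \<open>e sums (\<tau> / 2)\<close> by (simp add: sums_iff)
  finally have "measure \<mu> (\<Inter>n. A n) > 1 - \<tau>" using \<open>\<tau> > 0\<close> by linarith
  moreover have "equicontinuous_set T \<beta> b (\<Inter>n. A n)"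
    unfolding equicontinuous_set_def
  proof (intro allI impI)
    fix \<epsilon> :: real assume "\<epsilon> > 0"
    have "e \<longlonglongrightarrow> 0" using \<open>e sums (\<tau> / 2)\<close> summable_LIMSEQ_zero sums_summable by blast
    \<comment> \<open>The cells of \<open>A n\<close> have radius \<open>2 * e n\<close>, and
      \<open>equicontinuous_on_cells\<close> needs four radii below \<epsilon>; hence the factor
      \<open>8\<close>.\<close>
    hence "\<forall>\<^sub>F n in sequentially. e n < \<epsilon> / 8"
      using \<open>\<epsilon> > 0\<close> by (intro order_tendstoD) auto
    then obtain n where "e n < \<epsilon> / 8"
      using eventually_happens'[OF sequentially_bot] by blast
    then obtain \<delta> where "\<delta> > 0" "\<forall>x\<in>A n. \<forall>y\<in>A n.
        dist x y < \<delta> \<longrightarrow> (\<forall>w\<in>strip \<beta> b. dist (T w x) (T w y) < \<epsilon>)"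
      using equicontinuous_on_cells[OF F(1)[of n], of "2 * e n" \<epsilon>] unfolding A_def by auto
    thus "\<exists>\<delta>>0. \<forall>x\<in>\<Inter>n. A n. \<forall>y\<in>\<Inter>n. A n.
        dist x y < \<delta> \<longrightarrow> (\<forall>w\<in>strip \<beta> b. dist (T w x) (T w y) < \<epsilon>)"
      by (intro exI[of _ \<delta>]) blast
  qed
  ultimately show "\<exists>K\<in>sets \<mu>. equicontinuous_set T \<beta> b K \<and> measure \<mu> K > 1 - \<tau>"
    using meas by blast
qed

text \<open>The \<delta> of equicontinuity serves the whole strip, so one finite \<delta>-dense
  subset of \<open>K\<close> works for every \<open>k\<close>.\<close>

lemma equicontinuous_imp_bounded_complexity:
  assumes "measure_equicontinuous T \<mu> \<beta> b"
  shows "bounded_complexity T \<mu> \<beta> b"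
  unfolding bounded_complexity_def
proof (intro allI impI)
  fix \<epsilon> :: real assume "\<epsilon> > 0"
  hence "\<exists>K\<in>sets \<mu>. equicontinuous_set T \<beta> b K \<and> measure \<mu> K > 1 - \<epsilon>"
    using assms by (simp add: measure_equicontinuous_def)
  then obtain K where K: "K \<in> sets \<mu>" "equicontinuous_set T \<beta> b K" "measure \<mu> K > 1 - \<epsilon>"
    by (elim bexE conjE)
  have "\<exists>\<delta>>0. \<forall>x\<in>K. \<forall>y\<in>K. dist x y < \<delta> \<longrightarrow> (\<forall>w\<in>strip \<beta> b. dist (T w x) (T w y) < \<epsilon>)"
    using K(2) \<open>\<epsilon> > 0\<close> by (simp add: equicontinuous_set_def)
  then obtain \<delta> where \<delta>: "\<delta> > 0" "\<And>x y w. x \<in> K \<Longrightarrow> y \<in> K \<Longrightarrow> dist x y < \<delta> \<Longrightarrow>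
      w \<in> strip \<beta> b \<Longrightarrow> dist (T w x) (T w y) < \<epsilon>"
    by auto
  obtain P :: "'a set" where P: "finite P" "UNIV \<subseteq> (\<Union>x\<in>P. ball x (\<delta> / 2))"
    using compact_UNIV \<delta>(1) unfolding compact_eq_totally_bounded by (metis half_gt_zero)
  \<comment> \<open>Equicontinuity compares points of \<open>K\<close> only, so the centres of the
    cover are replaced by points of \<open>K\<close>. Halving \<delta> pays for this change.\<close>
  define c where "c p = (SOME x. x \<in> K \<inter> ball p (\<delta> / 2))" for p
  define F where "F = c ` {p \<in> P. K \<inter> ball p (\<delta> / 2) \<noteq> {}}"
  have c: "c p \<in> K \<inter> ball p (\<delta> / 2)" if "K \<inter> ball p (\<delta> / 2) \<noteq> {}" for p
    using that unfolding c_def by (metis some_in_eq)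
  have F: "finite F" "card F \<le> card P"
    using P(1) surj_card_le[of P F c] card_mono[of "c ` P" F] card_image_le[of P c]
    by (auto simp: F_def)
  have "measure \<mu> (\<Union>x\<in>F. dyn_ball T \<beta> b k x \<epsilon>) > 1 - \<epsilon>" if "k \<ge> 1" for k
  proof -
    have "K \<subseteq> (\<Union>x\<in>F. dyn_ball T \<beta> b k x \<epsilon>)"
    proof
      fix y assume y: "y \<in> K"
      obtain p where p: "p \<in> P" "y \<in> ball p (\<delta> / 2)" using P(2) by blast
      have ne: "K \<inter> ball p (\<delta> / 2) \<noteq> {}" using y p by blast
      note cp = c[OF this]
      have "c p \<in> F" using ne p(1) unfolding F_def by blast
      moreover have "dist (c p) y < \<delta>"
        using cp p(2) dist_triangle_half_r[of p "c p" \<delta> y] by auto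
      hence "y \<in> dyn_ball T \<beta> b k (c p) \<epsilon>"
        using \<delta>(2)[of "c p" y] y cp that b_pos
        by (auto simp: dyn_ball_def dyn_dist_less_iff strip_upto_def)
      ultimately show "y \<in> (\<Union>x\<in>F. dyn_ball T \<beta> b k x \<epsilon>)" by blast
    qed
    moreover have "(\<Union>x\<in>F. dyn_ball T \<beta> b k x \<epsilon>) \<in> sets \<mu>"
      unfolding sets_eq using that b_pos continuous
      by (intro borel_open open_UN ballI open_dyn_ball)
    ultimately have "measure \<mu> K \<le> measure \<mu> (\<Union>x\<in>F. dyn_ball T \<beta> b k x \<epsilon>)"
      by (rule finite_measure_mono)
    with K(3) show ?thesis by linarith
  qed
  with F show "\<exists>C>0. \<forall>k\<ge>1. \<exists>F. finite F \<and> card F \<le> C \<and>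
      measure \<mu> (\<Union>x\<in>F. dyn_ball T \<beta> b k x \<epsilon>) > 1 - \<epsilon>"
    \<comment> \<open>The successor guarantees a positive bound.\<close>
    by (intro exI[of _ "Suc (card P)"]) (auto intro!: exI[of _ F])
qed

end

theorem theorem1p2:
  fixes T :: "int \<times> int \<Rightarrow> 'a::metric_space \<Rightarrow> 'a"
    and \<mu> :: "'a measure" and \<beta> b :: real
  assumes "Z2_tds T"
    and "\<mu> \<in> invariant_measures T"
    and "b > 0"
  shows "bounded_complexity T \<mu> \<beta> b \<longleftrightarrow> measure_equicontinuous T \<mu> \<beta> b"
proof -
  interpret Z2_system T \<mu> \<beta> b
    using assms by unfold_locales
  show ?thesis
    using bounded_complexity_imp_equicontinuous equicontinuous_imp_bounded_complexity by blast
qed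

end
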